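(* For every $q\in[1,2]$ and every $\varepsilon\in(0,1)$ there is a constant $c(q,\varepsilon)>0$, depending only on $q$ and $\varepsilon$, such that the following holds. Let $N\in\mathbb N$ and let $K\subset\mathbb R^N$ be an unconditional set that is also invariant under cyclic shifts of coordinates. Then for every integer $n\ge 0$ with $n\le N(1-\varepsilon)$, $$d_n(K,\ell_q^N)\ \ge\ c(q,\varepsilon)\,\sup_{x\in K}\|x\|_q .$$
   Context: $\ell_q^N$ is $\mathbb R^N$ with the norm $\|x\|_q=(\sum_{k=1}^N|x_k|^q)^{1/q}$. A set $K\subset\mathbb R^N$ is unconditional if $(x_1,\dots,x_N)\in K$ implies $(\pm x_1,\dots,\pm x_N)\in K$ for every choice of signs. Invariance under cyclic shifts means that $(x_1,\dots,x_N)\in K$ implies $(x_{k+1},\dots,x_{k+N})\in K$ for all $k$, indices taken mod $N$. For a subset $K$ of a normed space $X$, the Kolmogorov width is $d_n(K,X)=\inf_{Q_n}\sup_{x\in K}\rho(x,Q_n)_X$, where $\rho(x,Q)_X=\inf_{y\in Q}\|x-y\|_X$ and the infimum is over all linear subspaces $Q_n\subset X$ of dimension at most $n$. Suprema are taken in $[0,\infty]$. *)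

theory Defs
  imports "HOL-Analysis.Analysis" "HOL-Library.Function_Algebras"
begin

(* The library makes functions an additive group pointwise, but not a real vector space. *)

instantiation "fun" :: (type, real_vector) real_vector
begin

definition scaleR_fun :: "real \<Rightarrow> ('a \<Rightarrow> 'b) \<Rightarrow> 'a \<Rightarrow> 'b" where
  "scaleR_fun c f = (\<lambda>i. c *\<^sub>R f i)"

instance
  by standard (simp_all add: scaleR_fun_def fun_eq_iff scaleR_add_right scaleR_add_left)

end

(* R^N is realised inside nat => real, with coordinates 0, ..., N-1, so that N may be
   quantified over; this is also the point set of the library's Euclidean_space N. *)

definition coord_space :: "nat \<Rightarrow> (nat \<Rightarrow> real) set" where
  "coord_space N = {x. \<forall>i\<ge>N. x i = 0}"

definition lq_norm :: "real \<Rightarrow> nat \<Rightarrow> (nat \<Rightarrow> real) \<Rightarrow> real" where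
  "lq_norm q N x = (\<Sum>i<N. \<bar>x i\<bar> powr q) powr (1 / q)"

definition unconditional :: "nat \<Rightarrow> (nat \<Rightarrow> real) set \<Rightarrow> bool" where
  "unconditional N K \<longleftrightarrow>
     (\<forall>x\<in>K. \<forall>s::nat \<Rightarrow> real. (\<forall>i<N. s i = 1 \<or> s i = -1) \<longrightarrow>
        (\<lambda>i. if i < N then s i * x i else 0) \<in> K)"

definition cyclic_shift :: "nat \<Rightarrow> nat \<Rightarrow> (nat \<Rightarrow> real) \<Rightarrow> nat \<Rightarrow> real" where
  "cyclic_shift N k x = (\<lambda>i. if i < N then x ((i + k) mod N) else 0)"

definition cyclic_shift_invariant :: "nat \<Rightarrow> (nat \<Rightarrow> real) set \<Rightarrow> bool" where
  "cyclic_shift_invariant N K \<longleftrightarrow> (\<forall>x\<in>K. \<forall>k. cyclic_shift N k x \<in> K)"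

(* A normed space is given by its set of points X (a subspace of the ambient type) and
   its norm nrm; distances are taken in [0,\<infinity>]. *)

definition dist_to :: "('a::real_vector \<Rightarrow> real) \<Rightarrow> 'a \<Rightarrow> 'a set \<Rightarrow> ennreal" where
  "dist_to nrm x Q = (INF y\<in>Q. ennreal (nrm (x - y)))"

(* The existence of a finite spanning set is required separately because dim is 0 on
   infinite-dimensional subspaces. *)

definition subspaces_dim_le :: "nat \<Rightarrow> 'a::real_vector set \<Rightarrow> 'a set set" where
  "subspaces_dim_le n X =
     {Q. subspace Q \<and> Q \<subseteq> X \<and> (\<exists>B. finite B \<and> span B = Q) \<and> dim Q \<le> n}"

definition kolmogorov_width ::
  "nat \<Rightarrow> 'a::real_vector set \<Rightarrow> 'a set \<Rightarrow> ('a \<Rightarrow> real) \<Rightarrow> ennreal" where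
  "kolmogorov_width n K X nrm =
     (INF Q\<in>subspaces_dim_le n X. SUP x\<in>K. dist_to nrm x Q)"

end

theory Submission
  imports Defs
begin

text \<open>
  Let \<open>Q\<close> be a subspace of dimension at most \<open>n\<close>. The heart of the proof is that the coordinates
  carry weights \<open>w i\<close>, with \<open>\<Sum>i. w i \<ge> N - n\<close>, that depend on \<open>Q\<close> only and control from below the
  distance of sign changes: for every vector \<open>z\<close> some choice of signs \<open>s\<close> satisfies
  \<open>\<parallel>s z - y\<parallel>\<^sub>q\<^sup>q \<ge> \<kappa> * (\<Sum>i. w i * \<bar>z i\<bar> powr q)\<close> for all \<open>y \<in> Q\<close>, where \<open>\<kappa> > 0\<close> depends on \<open>q\<close> only.
  Applying this to all cyclic shifts of a point \<open>x \<in> K\<close> finishes the proof, since the average of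
  the right-hand side over the shifts is \<open>\<kappa> * (\<Sum>i. w i) / N * \<parallel>x\<parallel>\<^sub>q\<^sup>q \<ge> \<kappa> * \<epsilon> * \<parallel>x\<parallel>\<^sub>q\<^sup>q\<close>. It
  is essential that the same weights serve all shifts.

  The distance to \<open>Q\<close> is bounded below by duality, by testing with a vector \<open>v\<close> orthogonal to \<open>Q\<close>.

  For \<open>q = 1\<close> the test vector must be bounded by 1 in every coordinate. A vertex \<open>v\<close> of the section
  of the cube \<open>[-1, 1]\<^sup>N\<close> by the annihilator of \<open>Q\<close> has at least \<open>N - n\<close> coordinates of modulus 1
  (\<open>annihilator_meets_cube_in_vertex\<close>); the weights are \<open>\<bar>v i\<bar>\<close>, and the signs are chosen so
  that all terms of the pairing of \<open>v\<close> with \<open>s z\<close> are nonnegative.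

  For \<open>1 < q \<le> 2\<close> the test vector must be bounded in the dual \<open>\<ell>\<^sub>p\<close> norm, \<open>p = q / (q - 1) \<ge> 2\<close>, and
  it is random. Let \<open>P\<close> be the orthogonal projection onto the annihilator, let
  \<open>\<theta> i = sgn (z i) * \<bar>z i\<bar> powr (q - 1)\<close>, and for random signs \<open>s\<close> put \<open>v = P (s \<theta>)\<close>. The expected
  pairing of \<open>v\<close> with \<open>s z\<close> is \<open>W = (\<Sum>i. P i i * \<bar>z i\<bar> powr q)\<close>, and Khinchin's inequality,
  followed by Jensen's inequality for the weights \<open>(P i j)\<^sup>2\<close> (their sum over \<open>i\<close> is
  \<open>P j j \<le> 1\<close>), shows that the expectation of \<open>\<parallel>v\<parallel>\<^sub>p\<^sup>p\<close> is at most a constant times the same \<open>W\<close>.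
  So the weights \<open>P i i\<close>, whose sum is the trace of \<open>P\<close>, have the required property. The
  constant in Khinchin's inequality is unbounded as \<open>p\<close> grows, which is why \<open>q = 1\<close> is treated
  separately.
\<close>

section \<open>Underdetermined systems and subspaces\<close>

text \<open>Gaussian elimination. Allowing any finite set \<open>I\<close> of unknowns makes it possible to ask for
  solutions that vanish on prescribed coordinates.\<close>

lemma underdetermined_system_has_nonzero_solution:
  fixes C :: "('a \<Rightarrow> real) set"
  assumes "finite C" and "finite I" and "card C < card I"
  shows "\<exists>u. (\<exists>i\<in>I. u i \<noteq> 0) \<and> (\<forall>i. i \<notin> I \<longrightarrow> u i = 0) \<and> (\<forall>c\<in>C. (\<Sum>i\<in>I. c i * u i) = 0)"
  using assms
proof (induction "card C" arbitrary: C I rule: less_induct)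
  case less
  show ?case
  proof (cases "\<forall>c\<in>C. \<forall>i\<in>I. c i = 0")
    case True
    from less.prems have "I \<noteq> {}" by auto
    then show ?thesis
      using True by (intro exI[of _ "\<lambda>i. if i \<in> I then 1 else 0"]) auto
  next
    case False
    then obtain c p where cp: "c \<in> C" "p \<in> I" "c p \<noteq> 0" by blast
    define elim where "elim = (\<lambda>b i. b i - b p / c p * c i)"
    define C' where "C' = elim ` (C - {c})"
    have card1: "card C' \<le> card (C - {c})"
      unfolding C'_def using less.prems by (intro card_image_le) auto
    have card2: "card (C - {c}) < card C"
      using cp less.prems by (intro psubset_card_mono) auto
    have card3: "card C \<le> card (I - {p})"
      using less.prems cp by (simp add: card_Diff_singleton)
    have "finite C'" "finite (I - {p})" "card C' < card C" "card C' < card (I - {p})"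
      using card1 card2 card3 less.prems by (auto simp: C'_def)
    from less.hyps[OF this(3,1,2,4)]
    obtain u where u: "\<exists>i\<in>I - {p}. u i \<noteq> 0" "\<forall>i. i \<notin> I - {p} \<longrightarrow> u i = 0"
        "\<forall>b\<in>C'. (\<Sum>i\<in>I - {p}. b i * u i) = 0"
      by blast
    \<comment> \<open>The pivot coordinate is chosen to satisfy the pivot equation.\<close>
    define t where "t = - (\<Sum>i\<in>I - {p}. c i * u i) / c p"
    define v where "v = u(p := t)"
    have split: "(\<Sum>i\<in>I. b i * v i) = b p * t + (\<Sum>i\<in>I - {p}. b i * u i)" for b
    proof -
      have "(\<Sum>i\<in>I. b i * v i) = b p * v p + (\<Sum>i\<in>I - {p}. b i * v i)"
        using cp less.prems by (intro sum.remove) auto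
      also have "(\<Sum>i\<in>I - {p}. b i * v i) = (\<Sum>i\<in>I - {p}. b i * u i)"
        by (intro sum.cong) (auto simp: v_def)
      finally show ?thesis by (simp add: v_def)
    qed
    have pivot: "(\<Sum>i\<in>I. c i * v i) = 0"
      unfolding split using cp by (simp add: t_def)
    have "(\<Sum>i\<in>I. b i * v i) = 0" if b: "b \<in> C" for b
    proof (cases "b = c")
      case True
      then show ?thesis using pivot by simp
    next
      case False
      have "elim b \<in> C'" using b False by (simp add: C'_def)
      then have "0 = (\<Sum>i\<in>I - {p}. elim b i * u i)" using u(3) by simp
      also have "\<dots> = (\<Sum>i\<in>I - {p}. b i * u i) - b p / c p * (\<Sum>i\<in>I - {p}. c i * u i)"
        by (simp add: elim_def left_diff_distrib sum_subtractf sum_distrib_left mult.assoc)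
      also have "\<dots> = (\<Sum>i\<in>I. b i * v i)"
        unfolding split by (simp add: t_def)
      finally show ?thesis by simp
    qed
    moreover have "\<exists>i\<in>I. v i \<noteq> 0" using u(1) by (auto simp: v_def)
    moreover have "\<forall>i. i \<notin> I \<longrightarrow> v i = 0" using u(2) cp by (auto simp: v_def)
    ultimately show ?thesis by blast
  qed
qed

definition dot :: "nat \<Rightarrow> (nat \<Rightarrow> real) \<Rightarrow> (nat \<Rightarrow> real) \<Rightarrow> real" where
  "dot N u v = (\<Sum>i<N. u i * v i)"

lemma dot_commute: "dot N u v = dot N v u"
  by (simp add: dot_def mult.commute)

lemma dot_zero_on_span:
  assumes "\<And>b. b \<in> B \<Longrightarrow> dot N b v = 0" and "y \<in> span B"
  shows "dot N y v = 0"
  using assms(2)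
proof (induction rule: span_induct)
  case base
  have "subspace {y. dot N y v = 0}"
    by (auto simp: subspace_def dot_def scaleR_fun_def zero_fun_def plus_fun_def
        distrib_right sum.distrib mult.assoc simp flip: sum_distrib_left)
  then show ?case by simp
next
  case (step x)
  then show ?case using assms(1) by simp
qed

lemma finite_basis_of_subspaces_dim_le:
  assumes "Q \<in> subspaces_dim_le n X"
  obtains B where "finite B" and "card B \<le> n" and "span B = Q"
proof -
  obtain A where A: "finite A" "span A = Q" and dim: "dim Q \<le> n"
    using assms by (auto simp: subspaces_dim_le_def)
  obtain B where B: "B \<subseteq> Q" "independent B" "Q \<subseteq> span B" "card B = dim Q"
    using basis_exists by blast
  have "finite B"
    using independent_span_bound[of A B] A B by auto
  moreover have "span B = Q"
    using B A by (metis span_subspace subspace_span)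
  ultimately show ?thesis using that B dim by auto
qed

section \<open>A vector of the annihilator with many extreme coordinates\<close>

text \<open>From \<open>v\<close> with fewer than \<open>N - card C\<close> coordinates of modulus 1 there is a direction \<open>u\<close> inside the
  annihilator that leaves these coordinates fixed. Moving along \<open>u\<close> until the boundary of the
  cube is met adds one more such coordinate.\<close>

lemma annihilator_meets_cube_in_vertex:
  assumes C: "finite C" and k: "k + card C \<le> N"
  shows "\<exists>v. (\<forall>c\<in>C. dot N c v = 0) \<and> (\<forall>i<N. \<bar>v i\<bar> \<le> 1) \<and> k \<le> card {i. i < N \<and> \<bar>v i\<bar> = 1}"
  using k
proof (induction k)
  case 0
  show ?case by (intro exI[of _ "\<lambda>_. 0"]) (auto simp: dot_def)
next
  case (Suc k)
  then obtain v where v: "\<forall>c\<in>C. dot N c v = 0" "\<And>i. i < N \<Longrightarrow> \<bar>v i\<bar> \<le> 1"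
      "k \<le> card {i. i < N \<and> \<bar>v i\<bar> = 1}" by auto
  define T where "T = {i. i < N \<and> \<bar>v i\<bar> = 1}"
  show ?case
  proof (cases "Suc k \<le> card T")
    case True
    then show ?thesis using v by (auto simp: T_def)
  next
    case False
    then have cT: "card T = k" using v(3) by (simp add: T_def)
    have TN: "T \<subseteq> {..<N}" by (auto simp: T_def)
    have "card ({..<N} - T) = N - k"
      using TN cT by (subst card_Diff_subset) (auto intro: finite_subset)
    have "card C < card ({..<N} - T)" using \<open>card ({..<N} - T) = N - k\<close> Suc.prems by simp
    from underdetermined_system_has_nonzero_solution[OF C finite_Diff[OF finite_lessThan] this]
    obtain u where u: "\<exists>i\<in>{..<N} - T. u i \<noteq> 0" "\<forall>i. i \<notin> {..<N} - T \<longrightarrow> u i = 0"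
        "\<forall>c\<in>C. (\<Sum>i\<in>{..<N} - T. c i * u i) = 0"
      by blast
    have uC: "dot N c u = 0" if "c \<in> C" for c
    proof -
      have "dot N c u = (\<Sum>i\<in>{..<N} - T. c i * u i)"
        unfolding dot_def using u(2) by (intro sum.mono_neutral_right) auto
      then show ?thesis using u(3) that by simp
    qed
    define J where "J = {i. i < N \<and> u i \<noteq> 0}"
    have J: "finite J" "J \<noteq> {}" using u(1) by (auto simp: J_def)
    \<comment> \<open>The time at which coordinate \<open>i\<close> of \<open>v + t u\<close> reaches \<open>sgn (u i)\<close>.\<close>
    define hit where "hit = (\<lambda>i. (1 - sgn (u i) * v i) / \<bar>u i\<bar>)"
    define t where "t = Min (hit ` J)"
    define w where "w = (\<lambda>i. v i + t * u i)"
    have hit_nonneg: "0 \<le> hit i" if "i \<in> J" for i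
      using that v(2)[of i] by (auto simp: hit_def J_def sgn_if abs_le_iff)
    have t_le: "t \<le> hit i" if "i \<in> J" for i
      using that J by (simp add: t_def)
    have "t \<in> hit ` J" using J by (simp add: t_def)
    then obtain p where p: "p \<in> J" "t = hit p" by blast
    have t0: "0 \<le> t" using p hit_nonneg by simp
    have w_le: "\<bar>w i\<bar> \<le> 1" if "i < N" for i
    proof (cases "u i = 0")
      case True
      then show ?thesis using v(2)[OF that] by (simp add: w_def)
    next
      case False
      then have "t \<le> hit i" using t_le that by (simp add: J_def)
      then have "t * \<bar>u i\<bar> \<le> 1 - sgn (u i) * v i"
        using False by (simp add: hit_def pos_le_divide_eq)
      moreover have "0 \<le> t * \<bar>u i\<bar>" using t0 by simp
      ultimately show ?thesis
        using v(2)[OF that] False unfolding w_def by (cases "0 < u i") auto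
    qed
    have "w p = sgn (u p)"
      using p by (auto simp: w_def J_def hit_def sgn_if field_simps split: if_splits)
    moreover have "p \<notin> T" "p < N" "u p \<noteq> 0" using p u(2) by (auto simp: J_def)
    ultimately have "insert p T \<subseteq> {i. i < N \<and> \<bar>w i\<bar> = 1}"
      using u(2) by (auto simp: w_def T_def)
    then have "card (insert p T) \<le> card {i. i < N \<and> \<bar>w i\<bar> = 1}"
      by (intro card_mono) auto
    then have "Suc k \<le> card {i. i < N \<and> \<bar>w i\<bar> = 1}"
      using \<open>p \<notin> T\<close> cT TN by (simp add: finite_subset)
    moreover have "dot N c w = 0" if "c \<in> C" for c
    proof -
      have "dot N c w = dot N c v + t * dot N c u"
        by (simp add: dot_def w_def distrib_left sum.distrib sum_distrib_left mult.left_commute)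
      then show ?thesis using v(1) uC that by simp
    qed
    ultimately show ?thesis using w_le by blast
  qed
qed

section \<open>The orthogonal projection onto the annihilator\<close>

lemma orthonormal_family_in_annihilator:
  assumes C: "finite C" and k: "k + card C \<le> N"
  shows "\<exists>S. finite S \<and> card S = k \<and> (\<forall>b\<in>S. \<forall>c\<in>C. dot N c b = 0) \<and>
    (\<forall>a\<in>S. \<forall>b\<in>S. dot N a b = (if a = b then 1 else 0))"
  using k
proof (induction k)
  case 0
  show ?case by (intro exI[of _ "{}"]) auto
next
  case (Suc k)
  then obtain S where S: "finite S" "card S = k" "\<forall>b\<in>S. \<forall>c\<in>C. dot N c b = 0"
      "\<And>a b. a \<in> S \<Longrightarrow> b \<in> S \<Longrightarrow> dot N a b = (if a = b then 1 else 0)" by auto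
  have "card (C \<union> S) < card {..<N}"
    using card_Un_le[of C S] S(2) Suc.prems by simp
  then obtain u where u: "\<exists>i\<in>{..<N}. u i \<noteq> 0" "\<forall>c\<in>C \<union> S. dot N c u = 0"
    using underdetermined_system_has_nonzero_solution[of "C \<union> S" "{..<N}"] C S(1)
    unfolding dot_def by auto
  have pos: "dot N u u > 0"
    using u(1) unfolding dot_def by (auto intro!: sum_pos2 simp: zero_less_mult_iff)
  define b where "b = (\<lambda>i. u i / sqrt (dot N u u))"
  have bb: "dot N b b = 1"
    using pos by (simp add: dot_def b_def sum_nonneg flip: sum_divide_distrib)
  have b0: "dot N c b = 0" if "c \<in> C \<union> S" for c
    using u(2) that by (simp add: dot_def b_def flip: sum_divide_distrib)
  have "b \<notin> S" using b0[of b] bb by auto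
  moreover have "\<forall>c\<in>insert b S. \<forall>a\<in>insert b S. dot N c a = (if c = a then 1 else 0)"
  proof -
    have "dot N b c = 0" if "c \<in> S" for c
      using b0[of c] that by (simp add: dot_commute)
    then show ?thesis using S(4) bb b0 \<open>b \<notin> S\<close> by auto
  qed
  ultimately show ?case
    using S b0 by (intro exI[of _ "insert b S"]) auto
qed

text \<open>The matrix is \<open>\<Sum>b\<in>S. b b\<^sup>T\<close> for an orthonormal basis \<open>S\<close> of an \<open>(N - card C)\<close>-dimensional subspace
  of the annihilator. Of \<open>P P = P\<close> only the diagonal entries are stated: by symmetry they are
  \<open>\<Sum>i. (P i j)\<^sup>2 = P j j\<close>, a bound for the columns.\<close>

lemma projection_onto_annihilator:
  assumes C: "finite C" and card: "card C \<le> N"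
  obtains P :: "nat \<Rightarrow> nat \<Rightarrow> real" where
    "\<And>i j. P i j = P j i" and
    "\<And>j. (\<Sum>i<N. (P i j)\<^sup>2) = P j j" and
    "(\<Sum>i<N. P i i) = real (N - card C)" and
    "\<And>c i. c \<in> C \<Longrightarrow> dot N c (P i) = 0"
proof -
  obtain S where S: "finite S" "card S = N - card C" "\<forall>b\<in>S. \<forall>c\<in>C. dot N c b = 0"
      "\<And>a b. a \<in> S \<Longrightarrow> b \<in> S \<Longrightarrow> dot N a b = (if a = b then 1 else 0)"
    using orthonormal_family_in_annihilator[OF C, of "N - card C" N] card by auto
  define P where "P = (\<lambda>i j. \<Sum>b\<in>S. b i * b j :: real)"
  show ?thesis
  proof
    show "P i j = P j i" for i j
      by (simp add: P_def mult.commute)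
  next
    fix j
    have "(\<Sum>i<N. (P i j)\<^sup>2) = (\<Sum>i<N. \<Sum>a\<in>S. \<Sum>b\<in>S. (a j * b j) * (a i * b i))"
      by (simp add: P_def power2_eq_square sum_product mult_ac)
    also have "\<dots> = (\<Sum>a\<in>S. \<Sum>b\<in>S. \<Sum>i<N. (a j * b j) * (a i * b i))"
      by (subst sum.swap) (intro sum.cong refl sum.swap)
    also have "\<dots> = (\<Sum>a\<in>S. \<Sum>b\<in>S. (a j * b j) * dot N a b)"
      by (simp add: dot_def sum_distrib_left)
    also have "\<dots> = (\<Sum>a\<in>S. \<Sum>b\<in>S. if a = b then a j * b j else 0)"
      by (intro sum.cong refl) (auto simp: S(4))
    also have "\<dots> = P j j"
      using S(1) by (simp add: P_def)
    finally show "(\<Sum>i<N. (P i j)\<^sup>2) = P j j" .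
  next
    have "(\<Sum>i<N. P i i) = (\<Sum>b\<in>S. dot N b b)"
      unfolding P_def dot_def by (rule sum.swap)
    also have "\<dots> = real (N - card C)"
      using S(2,4) by simp
    finally show "(\<Sum>i<N. P i i) = real (N - card C)" .
  next
    fix c i assume c: "c \<in> C"
    have "dot N c (P i) = (\<Sum>j<N. \<Sum>b\<in>S. b i * (c j * b j))"
      by (simp add: dot_def P_def sum_distrib_left mult_ac)
    also have "\<dots> = (\<Sum>b\<in>S. b i * dot N c b)"
      by (subst sum.swap) (simp add: dot_def sum_distrib_left)
    also have "\<dots> = 0" using S(3) c by simp
    finally show "dot N c (P i) = 0" .
  qed
qed

section \<open>Khinchin's inequality\<close>

text \<open>Expectations over independent random signs are written as sums over this finite set, so that
  independence becomes the factorisation \<open>sum_signs_prod\<close>.\<close>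

definition signs :: "'a set \<Rightarrow> ('a \<Rightarrow> real) set" where
  "signs I = (\<Pi>\<^sub>E i\<in>I. {1, -1})"

lemma finite_signs [simp]: "finite I \<Longrightarrow> finite (signs I)"
  by (auto simp: signs_def intro: finite_PiE)

lemma card_signs: "finite I \<Longrightarrow> card (signs I) = 2 ^ card I"
  by (simp add: signs_def card_PiE numeral_2_eq_2)

lemma signsD: "s \<in> signs I \<Longrightarrow> i \<in> I \<Longrightarrow> s i = 1 \<or> s i = -1"
  by (auto simp: signs_def PiE_iff)

lemma sum_signs_prod:
  fixes f :: "'a \<Rightarrow> real \<Rightarrow> real"
  assumes "finite I"
  shows "(\<Sum>s\<in>signs I. \<Prod>i\<in>I. f i (s i)) = (\<Prod>i\<in>I. f i 1 + f i (-1))"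
  unfolding signs_def using assms by (subst prod_sum_PiE[symmetric]) auto

lemma sum_signs_mult:
  assumes I: "finite I" and ij: "i \<in> I" "j \<in> I"
  shows "(\<Sum>s\<in>signs I. s i * s j) = (if i = j then 2 ^ card I else 0)"
proof (cases "i = j")
  case True
  have "s i * s j = 1" if "s \<in> signs I" for s
    using signsD[OF that ij(1)] True by auto
  then show ?thesis using True card_signs[OF I] by simp
next
  case False
  have "(\<Sum>s\<in>signs I. s i * s j) = (\<Sum>s\<in>signs I. \<Prod>k\<in>I. (if k = i \<or> k = j then s k else 1))"
  proof (intro sum.cong refl)
    fix s :: "'a \<Rightarrow> real"
    have "(\<Prod>k\<in>I. (if k = i \<or> k = j then s k else 1)) = (\<Prod>k\<in>{i, j}. s k)"
      using I ij by (intro prod.mono_neutral_cong_right) auto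
    then show "s i * s j = (\<Prod>k\<in>I. (if k = i \<or> k = j then s k else 1))"
      using False by simp
  qed
  also have "\<dots> = (\<Prod>k\<in>I. (if k = i \<or> k = j then 1 else 1) + (if k = i \<or> k = j then -1 else 1))"
    by (rule sum_signs_prod[OF I])
  also have "\<dots> = 0" using I ij by (intro prod_zero) auto
  finally show ?thesis using False by simp
qed

text \<open>Termwise comparison of the power series, by \<open>2 ^ n * fact n \<le> fact (2 * n)\<close>.\<close>

lemma cosh_le_exp_half_square: "cosh x \<le> exp (x\<^sup>2 / 2)" for x :: real
proof -
  have cosh: "(\<lambda>n. x ^ (2 * n) / fact (2 * n)) sums cosh x"
  proof -
    have "strict_mono ((*) (2::nat))" by (auto simp: strict_mono_def)
    then have "(\<lambda>n. (if even (2 * n) then x ^ (2 * n) /\<^sub>R fact (2 * n) else 0)) sums cosh x"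
      by (subst sums_mono_reindex) (auto intro: cosh_converges elim!: evenE)
    then show ?thesis by (simp add: field_simps)
  qed
  have exp: "(\<lambda>n. (x\<^sup>2 / 2) ^ n / fact n) sums exp (x\<^sup>2 / 2)"
    using exp_converges[of "x\<^sup>2 / 2"] by (simp add: field_simps)
  have fact_double: "2 ^ n * fact n \<le> (fact (2 * n) :: real)" for n
  proof (induction n)
    case (Suc n)
    have "2 ^ Suc n * fact (Suc n) = 2 * (1 + real n) * (2 ^ n * fact n)"
      by simp
    also have "\<dots> \<le> 2 * (1 + real n) * fact (2 * n)"
      using Suc by (intro mult_left_mono) auto
    also have "\<dots> = (2 * (1 + real n) * fact (2 * n)) * 1"
      by simp
    also have "\<dots> \<le> (2 * (1 + real n) * fact (2 * n)) * (2 * real n + 1)"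
      by (intro mult_left_mono) auto
    also have "\<dots> = fact (2 * Suc n)"
      by (simp add: algebra_simps)
    finally show ?case .
  qed simp
  show ?thesis
  proof (rule sums_le[OF _ cosh exp])
    fix n
    have "x ^ (2 * n) / fact (2 * n) \<le> x ^ (2 * n) / (2 ^ n * fact n)"
      using fact_double by (intro divide_left_mono) (auto simp: power_mult)
    also have "\<dots> = (x\<^sup>2 / 2) ^ n / fact n"
      by (simp add: power_divide power_mult)
    finally show "x ^ (2 * n) / fact (2 * n) \<le> (x\<^sup>2 / 2) ^ n / fact n" .
  qed
qed

text \<open>This is \<open>t \<le> exp t\<close> at \<open>t = u / p\<close>, raised to the power \<open>p\<close>.\<close>

lemma powr_le_exp: "u powr p \<le> p powr p * exp u" if "0 \<le> u" "0 < p" for u p :: real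
proof -
  have "u / p \<le> exp (u / p)"
    using exp_ge_add_one_self[of "u / p"] by linarith
  then have "(u / p) powr p \<le> exp (u / p) powr p"
    using that by (intro powr_mono2) auto
  also have "\<dots> = exp u" using that by (simp add: powr_def)
  finally show ?thesis using that by (simp add: powr_divide field_simps)
qed

text \<open>After normalising to \<open>\<Sum>i. (a i)\<^sup>2 = 1\<close>, the random sum is subgaussian: its exponential moments
  factor into hyperbolic cosines. They dominate every power by \<open>powr_le_exp\<close>.\<close>

lemma Khinchin_inequality:
  fixes a :: "'a \<Rightarrow> real"
  assumes I: "finite I" and p: "0 < p"
  shows "(\<Sum>s\<in>signs I. \<bar>\<Sum>i\<in>I. a i * s i\<bar> powr p)
    \<le> 2 * p powr p * exp (1/2) * 2 ^ card I * (\<Sum>i\<in>I. (a i)\<^sup>2) powr (p / 2)"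
proof (cases "\<forall>i\<in>I. a i = 0")
  case True
  then show ?thesis using p by simp
next
  case False
  define \<sigma> where "\<sigma> = sqrt (\<Sum>i\<in>I. (a i)\<^sup>2)"
  have sq: "0 < (\<Sum>i\<in>I. (a i)\<^sup>2)"
    using False I by (auto intro!: sum_pos2)
  then have \<sigma>: "0 < \<sigma>" by (simp add: \<sigma>_def)
  define b where "b = (\<lambda>i. a i / \<sigma>)"
  have b1: "(\<Sum>i\<in>I. (b i)\<^sup>2) = 1"
    using sq by (simp add: b_def \<sigma>_def power_divide sum_nonneg flip: sum_divide_distrib)
  have mgf: "(\<Sum>s\<in>signs I. exp (e * (\<Sum>i\<in>I. b i * s i))) \<le> 2 ^ card I * exp (1/2)"
    if e: "e = 1 \<or> e = -1" for e :: real
  proof -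
    have "(\<Sum>s\<in>signs I. exp (e * (\<Sum>i\<in>I. b i * s i))) = (\<Sum>s\<in>signs I. \<Prod>i\<in>I. exp (e * (b i * s i)))"
      using I by (simp add: exp_sum sum_distrib_left)
    also have "\<dots> = (\<Prod>i\<in>I. exp (e * (b i * 1)) + exp (e * (b i * (-1))))"
      by (rule sum_signs_prod[OF I])
    also have "\<dots> = (\<Prod>i\<in>I. 2 * cosh (b i))"
      using e by (intro prod.cong) (auto simp: cosh_field_def)
    also have "\<dots> \<le> (\<Prod>i\<in>I. 2 * exp ((b i)\<^sup>2 / 2))"
      by (intro prod_mono) (auto intro: cosh_le_exp_half_square)
    also have "\<dots> = 2 ^ card I * exp (1/2)"
      using I b1 by (simp add: prod.distrib exp_sum[symmetric] flip: sum_divide_distrib)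
    finally show ?thesis .
  qed
  have "(\<Sum>s\<in>signs I. \<bar>\<Sum>i\<in>I. b i * s i\<bar> powr p)
      \<le> (\<Sum>s\<in>signs I. p powr p * (exp (1 * (\<Sum>i\<in>I. b i * s i)) + exp (-1 * (\<Sum>i\<in>I. b i * s i))))"
  proof (intro sum_mono)
    fix s
    define S where "S = (\<Sum>i\<in>I. b i * s i)"
    have "\<bar>S\<bar> powr p \<le> p powr p * exp \<bar>S\<bar>"
      using p by (intro powr_le_exp) auto
    also have "\<dots> \<le> p powr p * (exp (1 * S) + exp (-1 * S))"
      by (intro mult_left_mono) (auto simp: abs_if)
    finally show "\<bar>\<Sum>i\<in>I. b i * s i\<bar> powr p
        \<le> p powr p * (exp (1 * (\<Sum>i\<in>I. b i * s i)) + exp (-1 * (\<Sum>i\<in>I. b i * s i)))"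
      by (simp add: S_def)
  qed
  also have "\<dots> = p powr p * ((\<Sum>s\<in>signs I. exp (1 * (\<Sum>i\<in>I. b i * s i)))
      + (\<Sum>s\<in>signs I. exp (-1 * (\<Sum>i\<in>I. b i * s i))))"
    by (simp only: sum_distrib_left[symmetric] sum.distrib)
  also have "\<dots> \<le> p powr p * (2 ^ card I * exp (1/2) + 2 ^ card I * exp (1/2))"
    by (intro mult_left_mono add_mono mgf) auto
  finally have normalized: "(\<Sum>s\<in>signs I. \<bar>\<Sum>i\<in>I. b i * s i\<bar> powr p)
      \<le> 2 * p powr p * exp (1/2) * 2 ^ card I" by (simp add: algebra_simps)
  have scale: "(\<Sum>i\<in>I. a i * s i) = \<sigma> * (\<Sum>i\<in>I. b i * s i)" for s
    using \<sigma> by (simp add: b_def sum_distrib_left)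
  have "(\<Sum>s\<in>signs I. \<bar>\<Sum>i\<in>I. a i * s i\<bar> powr p)
      = \<sigma> powr p * (\<Sum>s\<in>signs I. \<bar>\<Sum>i\<in>I. b i * s i\<bar> powr p)"
    using \<sigma> unfolding scale by (simp add: abs_mult powr_mult flip: sum_distrib_left)
  also have "\<dots> \<le> \<sigma> powr p * (2 * p powr p * exp (1/2) * 2 ^ card I)"
    by (intro mult_left_mono normalized) auto
  also have "\<sigma> powr p = (\<Sum>i\<in>I. (a i)\<^sup>2) powr (p / 2)"
    using sq by (simp add: \<sigma>_def powr_half_sqrt[symmetric] powr_powr)
  finally show ?thesis by (simp add: mult_ac)
qed

text \<open>Jensen's inequality for \<open>u powr r\<close>. Total mass below 1 is harmless because \<open>0 powr r = 0\<close>.\<close>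

lemma powr_sum_le_of_subprobability:
  fixes w u :: "'a \<Rightarrow> real"
  assumes r: "1 \<le> r" and w: "\<And>i. i \<in> I \<Longrightarrow> 0 \<le> w i" "sum w I \<le> 1"
    and u: "\<And>i. i \<in> I \<Longrightarrow> 0 \<le> u i"
  shows "(\<Sum>i\<in>I. w i * u i) powr r \<le> (\<Sum>i\<in>I. w i * u i powr r)"
proof (cases "r = 1")
  case True
  then show ?thesis using w u by (simp add: sum_nonneg)
next
  case False
  then have r1: "1 < r" using r by simp
  define M where "M = (\<Sum>i\<in>I. w i * u i)"
  have M: "0 \<le> M" using w u by (auto simp: M_def intro!: sum_nonneg)
  \<comment> \<open>Young's inequality with exponents \<open>r\<close> and \<open>r / (r - 1)\<close> is the tangent line bound at \<open>M\<close>.\<close>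
  have tangent: "r * u i * M powr (r - 1) \<le> u i powr r + (r - 1) * M powr r" if "i \<in> I" for i
  proof -
    have "u i * M powr (r - 1) \<le> u i powr r / r + (M powr (r - 1)) powr (r / (r - 1)) / (r / (r - 1))"
      using r1 u[OF that] by (intro Youngs_inequality) (auto simp: field_simps)
    also have "(M powr (r - 1)) powr (r / (r - 1)) = M powr r"
      using r1 by (simp add: powr_powr)
    finally show ?thesis using r1 by (simp add: field_simps)
  qed
  have "r * M powr r = (\<Sum>i\<in>I. w i * (r * u i * M powr (r - 1)))"
  proof -
    have "M powr r = M * M powr (r - 1)"
      using M by (cases "M = 0") (auto simp: powr_mult_base)
    then show ?thesis
      by (simp add: M_def sum_distrib_left sum_distrib_right mult_ac)
  qed
  also have "\<dots> \<le> (\<Sum>i\<in>I. w i * (u i powr r + (r - 1) * M powr r))"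
    using tangent w by (intro sum_mono mult_left_mono) auto
  also have "\<dots> = (\<Sum>i\<in>I. w i * u i powr r) + sum w I * ((r - 1) * M powr r)"
    by (simp add: distrib_left sum.distrib sum_distrib_right)
  also have "sum w I * ((r - 1) * M powr r) \<le> 1 * ((r - 1) * M powr r)"
    using w r1 by (intro mult_right_mono) auto
  finally show ?thesis by (simp add: M_def algebra_simps)
qed

section \<open>Weighted lower bounds for sign vectors\<close>

lemma ex_ge_average:
  fixes f :: "'a \<Rightarrow> real"
  assumes "finite A" and "A \<noteq> {}" and "real (card A) * K \<le> sum f A"
  shows "\<exists>a\<in>A. K \<le> f a"
proof (rule ccontr)
  assume "\<not> ?thesis"
  then have "sum f A < of_nat (card A) * K"
    using assms by (intro sum_bounded_above_strict) (auto simp: card_gt_0_iff)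
  then show False using assms(3) by simp
qed

text \<open>The signs may depend on \<open>z\<close>, but the weights \<open>w\<close> may not: this is what lets the bound be averaged
  over the shifts of one vector.\<close>

definition sign_distance_bound ::
    "real \<Rightarrow> real \<Rightarrow> nat \<Rightarrow> (nat \<Rightarrow> real) \<Rightarrow> (nat \<Rightarrow> real) set \<Rightarrow> bool" where
  "sign_distance_bound q \<kappa> N w Q \<longleftrightarrow>
    (\<forall>z. \<exists>s. (\<forall>i<N. s i = 1 \<or> s i = -1) \<and>
      (\<forall>y\<in>Q. \<kappa> * (\<Sum>i<N. w i * \<bar>z i\<bar> powr q) \<le> (\<Sum>i<N. \<bar>s i * z i - y i\<bar> powr q)))"

lemma sign_vector_far_from_subspace_l1:
  assumes B: "finite B" "card B \<le> N"
  shows "\<exists>w. real (N - card B) \<le> (\<Sum>i<N. w i) \<and> sign_distance_bound 1 1 N w (span B)"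
proof -
  obtain v where v: "\<And>b. b \<in> B \<Longrightarrow> dot N b v = 0" "\<And>i. i < N \<Longrightarrow> \<bar>v i\<bar> \<le> 1"
      "N - card B \<le> card {i. i < N \<and> \<bar>v i\<bar> = 1}"
    using annihilator_meets_cube_in_vertex[OF B(1), of "N - card B" N] B(2) by auto
  have "real (card {i. i < N \<and> \<bar>v i\<bar> = 1}) = (\<Sum>i\<in>{i. i < N \<and> \<bar>v i\<bar> = 1}. \<bar>v i\<bar>)"
    by simp
  also have "\<dots> \<le> (\<Sum>i<N. \<bar>v i\<bar>)"
    by (intro sum_mono2) auto
  finally have mass: "real (N - card B) \<le> (\<Sum>i<N. \<bar>v i\<bar>)"
    using v(3) by linarith
  have "\<exists>s. (\<forall>i<N. s i = 1 \<or> s i = -1) \<and>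
      (\<forall>y\<in>span B. (\<Sum>i<N. \<bar>v i\<bar> * \<bar>z i\<bar>) \<le> (\<Sum>i<N. \<bar>s i * z i - y i\<bar>))" for z :: "nat \<Rightarrow> real"
  proof (intro exI conjI ballI)
    define s where "s = (\<lambda>i. if 0 \<le> z i * v i then 1 else - 1 :: real)"
    show "\<forall>i<N. s i = 1 \<or> s i = -1" by (simp add: s_def)
    fix y assume y: "y \<in> span B"
    have "(\<Sum>i<N. \<bar>v i\<bar> * \<bar>z i\<bar>) = (\<Sum>i<N. s i * z i * v i)"
      by (intro sum.cong) (auto simp: s_def abs_mult[symmetric] mult.commute)
    also have "\<dots> = (\<Sum>i<N. (s i * z i - y i) * v i)"
      using dot_zero_on_span[OF v(1) y] by (simp add: dot_def left_diff_distrib sum_subtractf)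
    also have "\<dots> \<le> (\<Sum>i<N. \<bar>s i * z i - y i\<bar>)"
    proof (intro sum_mono)
      fix i assume "i \<in> {..<N}"
      then have "\<bar>s i * z i - y i\<bar> * \<bar>v i\<bar> \<le> \<bar>s i * z i - y i\<bar> * 1"
        using v(2) by (intro mult_left_mono) auto
      then show "(s i * z i - y i) * v i \<le> \<bar>s i * z i - y i\<bar>"
        by (simp add: abs_mult[symmetric])
    qed
    finally show "(\<Sum>i<N. \<bar>v i\<bar> * \<bar>z i\<bar>) \<le> (\<Sum>i<N. \<bar>s i * z i - y i\<bar>)" .
  qed
  then show ?thesis
    using mass by (intro exI[of _ "\<lambda>i. \<bar>v i\<bar>"]) (simp add: sign_distance_bound_def)
qed

text \<open>The weights are the diagonal entries of the projection. The parameter \<open>\<eta>\<close> in Young's inequality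
  is chosen so that the \<open>p\<close>-th moment of the random test vector uses up only half of the expected
  pairing; a sign vector that is at least as good as the average then works for all \<open>y\<close> at once.\<close>

lemma sign_vector_far_from_subspace_lq:
  fixes q :: real
  assumes q: "1 < q" "q \<le> 2"
  shows "\<exists>\<kappa>>0. \<forall>B N. finite B \<longrightarrow> card B \<le> N \<longrightarrow>
    (\<exists>w. real (N - card B) \<le> (\<Sum>i<N. w i) \<and> sign_distance_bound q \<kappa> N w (span B))"
proof -
  define p where "p = q / (q - 1)"
  have p: "2 \<le> p" "1 < p" "1 / p + 1 / q = 1" "(q - 1) * p = q"
    using q by (auto simp: p_def field_simps)
  define D where "D = 2 * p powr p * exp (1/2)"
  have D: "0 < D" using p by (simp add: D_def)
  define \<eta> where "\<eta> = (1 / (2 * D)) powr (1 / p)"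
  have \<eta>: "0 < \<eta>" "\<eta> powr p = 1 / (2 * D)"
    using D p by (auto simp: \<eta>_def powr_powr)
  define \<kappa> where "\<kappa> = \<eta> powr q / 2"
  have young: "a * b \<le> \<eta> powr p * \<bar>a\<bar> powr p + \<bar>b\<bar> powr q / \<eta> powr q" for a b :: real
  proof -
    have "a * b \<le> (\<eta> * \<bar>a\<bar>) * (\<bar>b\<bar> / \<eta>)"
      using \<eta> by (simp add: abs_mult[symmetric])
    also have "\<dots> \<le> (\<eta> * \<bar>a\<bar>) powr p / p + (\<bar>b\<bar> / \<eta>) powr q / q"
      using p q \<eta> by (intro Youngs_inequality) auto
    also have "\<dots> \<le> (\<eta> * \<bar>a\<bar>) powr p / 1 + (\<bar>b\<bar> / \<eta>) powr q / 1"
      using p q by (intro add_mono divide_left_mono) auto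
    finally show ?thesis using \<eta> by (simp add: powr_mult powr_divide)
  qed
  show ?thesis
  proof (intro exI[of _ \<kappa>] conjI allI impI)
    show "0 < \<kappa>" using \<eta> by (simp add: \<kappa>_def)
  next
    fix B :: "(nat \<Rightarrow> real) set" and N :: nat
    assume B: "finite B" "card B \<le> N"
    obtain P :: "nat \<Rightarrow> nat \<Rightarrow> real" where
      P_sym: "\<And>i j. P i j = P j i" and
      P_norm: "\<And>j. (\<Sum>i<N. (P i j)\<^sup>2) = P j j" and
      P_trace: "(\<Sum>i<N. P i i) = real (N - card B)" and
      P_ann: "\<And>b i. b \<in> B \<Longrightarrow> dot N b (P i) = 0"
      by (rule projection_onto_annihilator[OF B]) blast
    have P_nonneg: "0 \<le> P j j" for j
      using P_norm[of j] by (metis sum_nonneg zero_le_power2)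
    have P_le_1: "P j j \<le> 1" if "j < N" for j
    proof -
      have "(P j j)\<^sup>2 \<le> (\<Sum>i<N. (P i j)\<^sup>2)"
        using that by (intro member_le_sum) auto
      then have "P j j * P j j \<le> P j j * 1"
        unfolding P_norm by (simp add: power2_eq_square)
      then show ?thesis
        using P_nonneg[of j] by (cases "P j j = 0") auto
    qed
    have "\<exists>s. (\<forall>i<N. s i = 1 \<or> s i = -1) \<and>
        (\<forall>y\<in>span B. \<kappa> * (\<Sum>i<N. P i i * \<bar>z i\<bar> powr q) \<le> (\<Sum>i<N. \<bar>s i * z i - y i\<bar> powr q))"
      for z :: "nat \<Rightarrow> real"
    proof -
      define W where "W = (\<Sum>i<N. P i i * \<bar>z i\<bar> powr q)"
      define \<theta> where "\<theta> = (\<lambda>i. sgn (z i) * \<bar>z i\<bar> powr (q - 1))"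
      define v where "v = (\<lambda>s j. \<Sum>i<N. (P i j * \<theta> i) * s i)"
      have z\<theta>: "z i * \<theta> i = \<bar>z i\<bar> powr q" for i
        by (cases "z i = 0") (auto simp: \<theta>_def sgn_if powr_mult_base[symmetric] powr_diff)
      have \<theta>p: "((\<theta> i)\<^sup>2) powr (p / 2) = \<bar>z i\<bar> powr q" for i
      proof -
        have "(\<theta> i)\<^sup>2 = (\<bar>z i\<bar> powr (q - 1)) powr 2"
          by (cases "z i = 0") (auto simp: \<theta>_def power_mult_distrib sgn_if)
        then have "((\<theta> i)\<^sup>2) powr (p / 2) = \<bar>z i\<bar> powr ((q - 1) * (2 * (p / 2)))"
          by (simp only: powr_powr mult.assoc)
        then show ?thesis using p(4) by simp
      qed
      \<comment> \<open>Only the diagonal terms \<open>i = j\<close> survive averaging over the signs.\<close>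
      have pairing: "(\<Sum>s\<in>signs {..<N}. \<Sum>j<N. v s j * (s j * z j)) = 2 ^ N * W"
      proof -
        have "(\<Sum>s\<in>signs {..<N}. \<Sum>j<N. v s j * (s j * z j))
            = (\<Sum>s\<in>signs {..<N}. \<Sum>j<N. \<Sum>i<N. (P i j * \<theta> i * z j) * (s i * s j))"
          unfolding v_def sum_distrib_right by (intro sum.cong refl) (simp add: mult_ac)
        also have "\<dots> = (\<Sum>j<N. \<Sum>i<N. (P i j * \<theta> i * z j) * (\<Sum>s\<in>signs {..<N}. s i * s j))"
          by (subst sum.swap, intro sum.cong refl, subst sum.swap) (simp add: sum_distrib_left)
        also have "\<dots> = (\<Sum>j<N. \<Sum>i<N. if i = j then 2 ^ N * (P j j * \<bar>z j\<bar> powr q) else 0)"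
          by (intro sum.cong refl) (auto simp: sum_signs_mult z\<theta>[symmetric])
        also have "\<dots> = 2 ^ N * W"
          by (simp add: W_def sum_distrib_left)
        finally show ?thesis .
      qed
      have moment: "(\<Sum>s\<in>signs {..<N}. \<Sum>j<N. \<bar>v s j\<bar> powr p) \<le> D * 2 ^ N * W"
      proof -
        have "(\<Sum>s\<in>signs {..<N}. \<Sum>j<N. \<bar>v s j\<bar> powr p) = (\<Sum>j<N. \<Sum>s\<in>signs {..<N}. \<bar>v s j\<bar> powr p)"
          by (rule sum.swap)
        also have "\<dots> \<le> (\<Sum>j<N. D * 2 ^ N * (\<Sum>i<N. (P i j)\<^sup>2 * \<bar>z i\<bar> powr q))"
        proof (intro sum_mono)
          fix j assume j: "j \<in> {..<N}"
          have "(\<Sum>s\<in>signs {..<N}. \<bar>v s j\<bar> powr p)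
              \<le> D * 2 ^ N * (\<Sum>i<N. (P i j * \<theta> i)\<^sup>2) powr (p / 2)"
            using Khinchin_inequality[of "{..<N}" p "\<lambda>i. P i j * \<theta> i"] p by (simp add: v_def D_def)
          also have "(\<Sum>i<N. (P i j * \<theta> i)\<^sup>2) powr (p / 2)
              = (\<Sum>i<N. (P i j)\<^sup>2 * (\<theta> i)\<^sup>2) powr (p / 2)"
            by (simp add: power_mult_distrib)
          also have "D * 2 ^ N * \<dots> \<le> D * 2 ^ N * (\<Sum>i<N. (P i j)\<^sup>2 * ((\<theta> i)\<^sup>2) powr (p / 2))"
            using p D j P_le_1 P_norm
            by (intro mult_left_mono powr_sum_le_of_subprobability) auto
          finally show "(\<Sum>s\<in>signs {..<N}. \<bar>v s j\<bar> powr p)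
              \<le> D * 2 ^ N * (\<Sum>i<N. (P i j)\<^sup>2 * \<bar>z i\<bar> powr q)"
            by (simp add: \<theta>p)
        qed
        also have "\<dots> = D * 2 ^ N * (\<Sum>i<N. (\<Sum>j<N. (P j i)\<^sup>2) * \<bar>z i\<bar> powr q)"
          unfolding sum_distrib_left[symmetric] sum_distrib_right
          by (subst sum.swap) (simp add: P_sym)
        also have "\<dots> = D * 2 ^ N * W"
          by (simp add: P_norm W_def)
        finally show ?thesis .
      qed
      define F where "F = (\<lambda>s. (\<Sum>j<N. v s j * (s j * z j)) - \<eta> powr p * (\<Sum>j<N. \<bar>v s j\<bar> powr p))"
      have "real (card (signs {..<N})) * (W / 2) \<le> sum F (signs {..<N})"
      proof -
        have "\<eta> powr p * (\<Sum>s\<in>signs {..<N}. \<Sum>j<N. \<bar>v s j\<bar> powr p) \<le> \<eta> powr p * (D * 2 ^ N * W)"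
          using moment by (intro mult_left_mono) auto
        also have "\<dots> = W * 2 ^ N / 2" using D by (simp add: \<eta>(2))
        finally show ?thesis
          by (simp add: F_def sum_subtractf pairing card_signs flip: sum_distrib_left)
      qed
      moreover have "signs {..<N} \<noteq> {}"
        using card_signs[of "{..<N}"] by auto
      ultimately obtain s where s: "s \<in> signs {..<N}" "W / 2 \<le> F s"
        using ex_ge_average[OF finite_signs[OF finite_lessThan]] by blast
      have "\<kappa> * W \<le> (\<Sum>i<N. \<bar>s i * z i - y i\<bar> powr q)" if y: "y \<in> span B" for y
      proof -
        have "dot N y (v s) = (\<Sum>i<N. \<theta> i * s i * dot N y (P i))"
          unfolding dot_def v_def sum_distrib_left
          by (subst sum.swap) (simp add: mult_ac)
        also have "\<dots> = 0"
          using dot_zero_on_span[OF P_ann y] by simp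
        finally have vy: "(\<Sum>j<N. v s j * y j) = 0"
          by (simp add: dot_def mult.commute)
        \<comment> \<open>Orthogonality brings in \<open>y\<close> for free; \<open>F s\<close> does not involve it.\<close>
        have "(\<Sum>j<N. v s j * (s j * z j)) = (\<Sum>j<N. v s j * (s j * z j - y j))"
          using vy by (simp add: right_diff_distrib sum_subtractf)
        also have "\<dots> \<le> (\<Sum>j<N. \<eta> powr p * \<bar>v s j\<bar> powr p + \<bar>s j * z j - y j\<bar> powr q / \<eta> powr q)"
          by (intro sum_mono young)
        also have "\<dots> = \<eta> powr p * (\<Sum>j<N. \<bar>v s j\<bar> powr p)
            + (\<Sum>j<N. \<bar>s j * z j - y j\<bar> powr q) / \<eta> powr q"
          by (simp add: sum.distrib sum_distrib_left sum_divide_distrib)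
        finally have "W / 2 \<le> (\<Sum>j<N. \<bar>s j * z j - y j\<bar> powr q) / \<eta> powr q"
          using s(2) unfolding F_def by linarith
        then show ?thesis using \<eta> by (simp add: \<kappa>_def field_simps)
      qed
      then show ?thesis
        using signsD[OF s(1)] by (intro exI[of _ s]) (auto simp: W_def)
    qed
    then show "\<exists>w. real (N - card B) \<le> (\<Sum>i<N. w i) \<and> sign_distance_bound q \<kappa> N w (span B)"
      using P_trace by (intro exI[of _ "\<lambda>i. P i i"]) (simp add: sign_distance_bound_def)
  qed
qed

lemma sign_vector_far_from_subspace:
  fixes q :: real
  assumes q: "1 \<le> q" "q \<le> 2"
  shows "\<exists>\<kappa>>0. \<forall>B N. finite B \<longrightarrow> card B \<le> N \<longrightarrow>
    (\<exists>w. real (N - card B) \<le> (\<Sum>i<N. w i) \<and> sign_distance_bound q \<kappa> N w (span B))"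
proof (cases "q = 1")
  case True
  show ?thesis
    using sign_vector_far_from_subspace_l1 unfolding True by (intro exI[of _ 1]) simp
next
  case False
  then show ?thesis
    using sign_vector_far_from_subspace_lq[of q] q by simp
qed

section \<open>Averaging over cyclic shifts\<close>

text \<open>Passing from \<open>i\<close> to \<open>i + 1\<close> replaces the first term of the sum by a new last one, and the two are
  equal by periodicity.\<close>

lemma sum_shift_mod:
  fixes f :: "nat \<Rightarrow> real"
  shows "(\<Sum>k<N. f ((i + k) mod N)) = (\<Sum>k<N. f k)"
proof (induction i)
  case (Suc i)
  define g where "g = (\<lambda>k. f ((i + k) mod N))"
  have "g 0 + (\<Sum>k<N. g (Suc k)) = (\<Sum>k<N. g k) + g N"
    using sum.lessThan_Suc[of g N] sum.lessThan_Suc_shift[of g N] by simp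
  then show ?case using Suc by (simp add: g_def)
qed simp

lemma ex_shift_ge_average:
  fixes w f :: "nat \<Rightarrow> real"
  assumes "0 < N"
  shows "\<exists>k. (\<Sum>i<N. w i) * (\<Sum>i<N. f i) / N \<le> (\<Sum>i<N. w i * f ((i + k) mod N))"
proof -
  have "(\<Sum>k<N. \<Sum>i<N. w i * f ((i + k) mod N)) = (\<Sum>i<N. w i * (\<Sum>k<N. f ((i + k) mod N)))"
    by (subst sum.swap) (simp add: sum_distrib_left)
  also have "\<dots> = (\<Sum>i<N. w i) * (\<Sum>i<N. f i)"
    by (simp add: sum_shift_mod sum_distrib_right)
  finally show ?thesis
    using assms ex_ge_average[of "{..<N}" "(\<Sum>i<N. w i) * (\<Sum>i<N. f i) / N"
        "\<lambda>k. \<Sum>i<N. w i * f ((i + k) mod N)"] by auto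
qed

theorem theorem1:
  fixes q \<epsilon> :: real
  assumes "1 \<le> q" and "q \<le> 2" and "0 < \<epsilon>" and "\<epsilon> < 1"
  shows "\<exists>c::real. c > 0 \<and>
    (\<forall>(N::nat) (K::(nat \<Rightarrow> real) set) (n::nat).
       K \<subseteq> coord_space N \<longrightarrow> unconditional N K \<longrightarrow> cyclic_shift_invariant N K \<longrightarrow>
       real n \<le> real N * (1 - \<epsilon>) \<longrightarrow>
       kolmogorov_width n K (coord_space N) (lq_norm q N)
         \<ge> ennreal c * (SUP x\<in>K. ennreal (lq_norm q N x)))"
proof -
  obtain \<kappa> where \<kappa>: "0 < \<kappa>" and far: "\<forall>B N. finite B \<longrightarrow> card B \<le> N \<longrightarrow>
      (\<exists>w. real (N - card B) \<le> (\<Sum>i<N. w i) \<and> sign_distance_bound q \<kappa> N w (span B))"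
    using sign_vector_far_from_subspace[OF assms(1,2)] by blast
  define c where "c = (\<kappa> * \<epsilon>) powr (1 / q)"
  have "ennreal c * (SUP x\<in>K. ennreal (lq_norm q N x)) \<le> kolmogorov_width n K (coord_space N) (lq_norm q N)"
    if K: "unconditional N K" "cyclic_shift_invariant N K" and n: "real n \<le> real N * (1 - \<epsilon>)"
    for N K n
  proof (cases "N = 0")
    case True
    have "(SUP x\<in>K. (0::ennreal)) = 0"
      by (cases "K = {}") (auto simp: bot_ennreal)
    then show ?thesis using True by (simp add: lq_norm_def)
  next
    case False
    have "ennreal c * ennreal (lq_norm q N x) \<le> (SUP z\<in>K. dist_to (lq_norm q N) z Q)"
      if Q: "Q \<in> subspaces_dim_le n (coord_space N)" and x: "x \<in> K" for Q x
    proof -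
      obtain B where B: "finite B" "card B \<le> n" "span B = Q"
        using finite_basis_of_subspaces_dim_le[OF Q] .
      have nN: "real n \<le> real N - \<epsilon> * real N"
        using n by (simp add: algebra_simps)
      moreover have "0 \<le> \<epsilon> * real N" using assms by simp
      ultimately have "n \<le> N" by linarith
      then have BN: "card B \<le> N" using B by simp
      obtain w where w: "real (N - card B) \<le> (\<Sum>i<N. w i)"
        and sign: "sign_distance_bound q \<kappa> N w Q"
        using far B BN by blast
      define X where "X = (\<Sum>i<N. \<bar>x i\<bar> powr q)"
      have X: "0 \<le> X" by (auto simp: X_def intro: sum_nonneg)
      \<comment> \<open>The signs are chosen after the shift, for the shifted vector.\<close>
      obtain k where k: "(\<Sum>i<N. w i) * X / N \<le> (\<Sum>i<N. w i * \<bar>x ((i + k) mod N)\<bar> powr q)"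
        using ex_shift_ge_average[of N w "\<lambda>i. \<bar>x i\<bar> powr q"] False by (auto simp: X_def)
      obtain s where s: "\<forall>i<N. s i = 1 \<or> s i = -1"
        and s_far: "\<And>y. y \<in> Q \<Longrightarrow> \<kappa> * (\<Sum>i<N. w i * \<bar>x ((i + k) mod N)\<bar> powr q)
          \<le> (\<Sum>i<N. \<bar>s i * x ((i + k) mod N) - y i\<bar> powr q)"
        using sign[unfolded sign_distance_bound_def, rule_format, of "\<lambda>i. x ((i + k) mod N)"] by blast
      define z where "z = (\<lambda>i. if i < N then s i * cyclic_shift N k x i else 0)"
      have "z \<in> K"
        using K x s by (auto simp: z_def unconditional_def cyclic_shift_invariant_def)
      have "c * lq_norm q N x \<le> lq_norm q N (z - y)" if y: "y \<in> Q" for y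
      proof -
        have "\<epsilon> * real N \<le> (\<Sum>i<N. w i)"
          using w nN B(2) BN by (simp add: of_nat_diff)
        then have "\<epsilon> * X \<le> (\<Sum>i<N. w i) * X / N"
          using False X mult_right_mono[of "\<epsilon> * real N" "\<Sum>i<N. w i" X]
          by (simp add: pos_le_divide_eq mult_ac)
        then have "\<kappa> * \<epsilon> * X \<le> \<kappa> * (\<Sum>i<N. w i * \<bar>x ((i + k) mod N)\<bar> powr q)"
          using k \<kappa> by (simp add: mult.assoc)
        also have "\<dots> \<le> (\<Sum>i<N. \<bar>(z - y) i\<bar> powr q)"
          using s_far[OF y] by (simp add: z_def cyclic_shift_def)
        finally have "(\<kappa> * \<epsilon> * X) powr (1 / q) \<le> lq_norm q N (z - y)"
          unfolding lq_norm_def using \<kappa> X assms by (intro powr_mono2) auto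
        then show ?thesis
          using \<kappa> X assms by (simp add: c_def lq_norm_def X_def powr_mult)
      qed
      then have "ennreal c * ennreal (lq_norm q N x) \<le> dist_to (lq_norm q N) z Q"
        unfolding dist_to_def
        by (intro INF_greatest) (simp add: c_def lq_norm_def ennreal_leI flip: ennreal_mult)
      also have "\<dots> \<le> (SUP z\<in>K. dist_to (lq_norm q N) z Q)"
        using \<open>z \<in> K\<close> by (rule SUP_upper)
      finally show ?thesis .
    qed
    then show ?thesis
      unfolding kolmogorov_width_def SUP_mult_left_ennreal
      by (intro INF_greatest SUP_least)
  qed
  moreover have "0 < c" using \<kappa> assms by (simp add: c_def)
  ultimately show ?thesis by blast
qed

end
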